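(* Let $N$ be an integer exceeding $1$. Then the smallest prime number exceeding $N$ is the least divisor exceeding $1$ of the integer $N!^{N!^{N!}}-1$.
   Context: The expression $N!^{N!^{N!}}$ denotes the iterated power $(N!)^{\left((N!)^{(N!)}\right)}$, that is, $n^{(n^n)}$ with $n=N!$. "Exceeding" means strictly greater than. *)

theory Defs
  imports Complex_Main "HOL-Computational_Algebra.Primes"
begin

end

theory Submission
  imports Defs "HOL-Number_Theory.Residues"
begin

text \<open>
  Put n = N!. A prime dividing n^(n^n) - 1 does not divide n, so it exceeds N. Conversely, let p be
  the least prime exceeding N. A prime factor of n + 1 exceeds N, so p - 1 \<le> n, and by minimality
  every prime factor of p - 1 is at most N and hence divides n. Thus p - 1 divides n^n, and p divides
  n^(n^n) - 1 by Fermat's little theorem.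
\<close>

text \<open>Strong induction, splitting off one prime \<open>q\<close> at a time: each prime factor
  of \<open>m\<close>, counted with multiplicity, costs one factor \<open>n\<close>. The exponent
  \<open>m\<close> is a crude bound for their number.\<close>

lemma dvd_power_self_if_prime_divisors_dvd:
  fixes m n :: nat
  assumes "m > 0" and "\<And>q. prime q \<Longrightarrow> q dvd m \<Longrightarrow> q dvd n"
  shows "m dvd n ^ m"
  using assms
proof (induction m rule: less_induct)
  case (less m)
  show ?case
  proof (cases "m = 1")
    case False
    then obtain q where q: "prime q" "q dvd m"
      using prime_factor_nat by blast
    then obtain k where m: "m = q * k" by blast
    have "k > 0" using less.prems(1) m by simp
    moreover have "k < m"
      using m \<open>k > 0\<close> prime_gt_1_nat[OF q(1)] by simp
    ultimately have "k dvd n ^ k"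
      using less.IH less.prems(2) m by simp
    moreover have "q dvd n"
      using less.prems(2) q by blast
    ultimately have "m dvd n ^ Suc k"
      using m by (simp add: mult_dvd_mono)
    also have "n ^ Suc k dvd n ^ m"
      using \<open>k < m\<close> by (intro le_imp_power_dvd) simp
    finally show ?thesis .
  qed simp
qed

text \<open>Otherwise \<open>q\<close> would divide two consecutive numbers and hence 1;
  \<open>n > 0\<close> keeps the natural subtraction from truncating.\<close>

lemma not_dvd_power_minus_one_if_dvd:
  fixes n q k :: nat
  assumes "n > 0" "k > 0" "q > 1" "q dvd n"
  shows "\<not> q dvd n ^ k - 1"
proof
  assume "q dvd n ^ k - 1"
  moreover have "q dvd n ^ k"
    using assms by (meson dvd_power dvd_trans)
  moreover have "n ^ k \<ge> 1"
    using assms by simp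
  ultimately have "q dvd 1"
    using dvd_diffD1 by blast
  with assms(3) show False by simp
qed

lemma prime_dvd_power_minus_one:
  fixes n p k :: nat
  assumes "prime p" "\<not> p dvd n" "p - 1 dvd k"
  shows "p dvd n ^ k - 1"
proof -
  obtain j where "k = (p - 1) * j" using assms(3) by blast
  moreover have "[(n ^ (p - 1)) ^ j = 1 ^ j] (mod p)"
    using fermat_theorem[OF assms(1,2)] by (rule cong_pow)
  ultimately have "[n ^ k = 1] (mod p)"
    by (simp add: power_mult)
  then show ?thesis
    by (rule cong_to_1_nat)
qed

theorem theorem3:
  fixes N :: nat
  assumes "N > 1"
  shows "(LEAST p::nat. prime p \<and> p > N) =
         (LEAST d::nat. d > 1 \<and> d dvd (fact N ^ (fact N ^ fact N) - 1))"
proof -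
  define n :: nat where "n = fact N"
  define p where "p = (LEAST p::nat. prime p \<and> p > N)"
  have n_pos: "n > 0" by (simp add: n_def)
  have dvd_n_iff: "q dvd n \<longleftrightarrow> q \<le> N" if "prime q" for q
    using that by (simp add: n_def prime_dvd_fact_iff)
  have p: "prime p" "p > N"
    using LeastI_ex[of "\<lambda>p. prime p \<and> p > N"] bigger_prime[of N] by (auto simp: p_def)
  have p_le: "p \<le> q" if "prime q" "q > N" for q
    using that by (auto simp: p_def intro: Least_le)
  \<comment> \<open>Euclid's argument bounds \<open>p\<close>; this bound later allows the exponent
    \<open>p - 1\<close> to be raised to \<open>n\<close>.\<close>
  have "p - 1 \<le> n"
  proof -
    obtain q where q: "prime q" "q dvd n + 1"
      using prime_factor_nat[of "n + 1"] n_pos by auto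
    then have "\<not> q dvd n"
      by (metis dvd_add_right_iff not_prime_unit)
    then have "p \<le> q" using q p_le dvd_n_iff by simp
    moreover have "q \<le> n + 1" using q by (intro dvd_imp_le) auto
    ultimately show ?thesis by simp
  qed
  moreover have "p - 1 dvd n ^ (p - 1)"
  proof (rule dvd_power_self_if_prime_divisors_dvd)
    show pos: "p - 1 > 0" using prime_gt_1_nat[OF p(1)] by simp
    fix q assume q: "prime q" "q dvd p - 1"
    then have "q < p" using dvd_imp_le[of q "p - 1"] pos by simp
    \<comment> \<open>If \<open>q\<close> exceeded \<open>N\<close>, minimality would give
      \<open>p \<le> q\<close>, against \<open>q < p\<close>.\<close>
    then show "q dvd n" using p_le[of q] q dvd_n_iff by fastforce
  qed
  ultimately have "p - 1 dvd n ^ n"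
    by (meson dvd_trans le_imp_power_dvd)
  then have "p dvd n ^ (n ^ n) - 1"
    using p dvd_n_iff by (intro prime_dvd_power_minus_one) auto
  \<comment> \<open>The divisor \<open>d\<close> may be composite, so the bound is proved for a
    prime factor \<open>q\<close> of \<open>d\<close>.\<close>
  moreover have "p \<le> d" if d: "d > 1" "d dvd n ^ (n ^ n) - 1" for d
  proof -
    obtain q where q: "prime q" "q dvd d"
      using prime_factor_nat[of d] d by auto
    then have "q dvd n ^ (n ^ n) - 1"
      using d dvd_trans by blast
    then have "\<not> q dvd n"
      using not_dvd_power_minus_one_if_dvd n_pos prime_gt_1_nat[OF q(1)] by force
    then have "p \<le> q" using q p_le dvd_n_iff by simp
    also have "q \<le> d" using q d by (intro dvd_imp_le) auto
    finally show ?thesis .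
  qed
  ultimately have "(LEAST d. d > 1 \<and> d dvd n ^ (n ^ n) - 1) = p"
    using prime_gt_1_nat[OF p(1)] by (intro Least_equality) auto
  then show ?thesis by (simp add: p_def n_def)
qed

end
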